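(* Let $G$ be a finite abelian group and let $f\neq 0$ be a nonnegative function on $G$. Assume that $S$ is a subset of $\widehat{G}$ such that $\operatorname{supp}(f)\subseteq S$ and $S=S^{-1}$. Define the function $h$ on $G$ by $$\widehat{h}(\chi)=\begin{cases}\widehat{\sqrt{f}}(\chi), & \chi\in S,\\ 0, & \chi\notin S.\end{cases}$$ Then $f+M$ has an FSOS supported in $S$ for $$M:=2\,\|\widehat{\sqrt{f}}-\widehat{h}\|_{\ell^1}\cdot\|\widehat{h}\|_{\ell^1}+\|\widehat{\sqrt{f}}-\widehat{h}\|_{\ell^1}^2 .$$
   Context: For a finite abelian group $G$, $\widehat{G}$ is its character group under pointwise multiplication; $S^{-1}=\{\chi^{-1}:\chi\in S\}$. Every $f:G\to\mathbb{C}$ has a unique Fourier expansion $f=\sum_{\chi\in\widehat{G}}\widehat{f}(\chi)\chi$, and $\operatorname{supp}(f)=\{\chi:\widehat{f}(\chi)\ne0\}$. $\sqrt{f}$ is the pointwise nonnegative square root. For a function $g$ on $G$, $\|\widehat{g}\|_{\ell^1}=\sum_{\chi\in\widehat{G}}|\widehat{g}(\chi)|$. An FSOS (Fourier sum of squares) of a function $g$ on $G$ is an expression $g=\sum_{i\in I}|g_i|^2$ with a finite family of functions $g_i:G\to\mathbb{C}$; it is supported in $S$ if $\operatorname{supp}(g_i)\subseteq S$ for all $i\in I$. *)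

theory Defs
  imports Complex_Main "HOL-Algebra.Coset"
begin

definition complex_units :: "complex monoid"
  where "complex_units = \<lparr>carrier = - {0}, mult = (*), one = 1\<rparr>"

text \<open>A character of \<open>G\<close> is a homomorphism into the multiplicative group of \<open>\<complex>\<close>; for finite \<open>G\<close> its
  values automatically have modulus \<open>1\<close>. Characters are extensional functions, so that
  equality of characters is equality on the carrier of \<open>G\<close>.\<close>

definition character_group :: "('a, 'm) monoid_scheme \<Rightarrow> ('a \<Rightarrow> complex) monoid"
  where "character_group G =
    \<lparr>carrier = hom G complex_units \<inter> extensional (carrier G),
     mult = (\<lambda>\<chi> \<psi>. \<lambda>x\<in>carrier G. \<chi> x * \<psi> x),
     one = (\<lambda>x\<in>carrier G. 1)\<rparr>"

lemma comm_group_character_group: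
  assumes "group G"
  shows "comm_group (character_group G)"
proof -
  interpret group G by fact
  show ?thesis
  proof (rule comm_groupI)
    fix \<chi> assume \<chi>: "\<chi> \<in> carrier (character_group G)"
    have "(\<lambda>x\<in>carrier G. inverse (\<chi> x)) \<in> carrier (character_group G)"
      using \<chi> by (auto simp: character_group_def complex_units_def hom_def)
    moreover have "(\<lambda>x\<in>carrier G. inverse (\<chi> x)) \<otimes>\<^bsub>character_group G\<^esub> \<chi> = \<one>\<^bsub>character_group G\<^esub>"
      using \<chi> by (auto simp: character_group_def complex_units_def hom_def fun_eq_iff Pi_iff)
    ultimately show "\<exists>\<psi>\<in>carrier (character_group G). \<psi> \<otimes>\<^bsub>character_group G\<^esub> \<chi> = \<one>\<^bsub>character_group G\<^esub>"
      by blast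
  qed (auto simp: character_group_def complex_units_def hom_def fun_eq_iff extensional_def
        restrict_def mult_ac)
qed

text \<open>The coefficients of the unique expansion of \<open>f\<close> as a linear combination of
  characters. Only the values of \<open>f\<close> on the carrier of \<open>G\<close> matter; the coefficient family is
  taken extensional on the character group to make the description unique.\<close>

definition fourier :: "('a, 'm) monoid_scheme \<Rightarrow> ('a \<Rightarrow> complex) \<Rightarrow> ('a \<Rightarrow> complex) \<Rightarrow> complex"
  where "fourier G f =
    (THE c. c \<in> extensional (carrier (character_group G)) \<and>
       (\<forall>x\<in>carrier G. f x = (\<Sum>\<chi>\<in>carrier (character_group G). c \<chi> * \<chi> x)))"

definition fourier_supp :: "('a, 'm) monoid_scheme \<Rightarrow> ('a \<Rightarrow> complex) \<Rightarrow> ('a \<Rightarrow> complex) set"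
  where "fourier_supp G f = {\<chi> \<in> carrier (character_group G). fourier G f \<chi> \<noteq> 0}"

definition l1_norm :: "('a, 'm) monoid_scheme \<Rightarrow> (('a \<Rightarrow> complex) \<Rightarrow> complex) \<Rightarrow> real"
  where "l1_norm G c = (\<Sum>\<chi>\<in>carrier (character_group G). cmod (c \<chi>))"

definition is_FSOS ::
    "('a, 'm) monoid_scheme \<Rightarrow> ('a \<Rightarrow> complex) \<Rightarrow> 'i set \<Rightarrow> ('i \<Rightarrow> 'a \<Rightarrow> complex) \<Rightarrow> bool"
  where "is_FSOS G g I gs \<longleftrightarrow>
    finite I \<and> (\<forall>x\<in>carrier G. g x = complex_of_real (\<Sum>i\<in>I. (cmod (gs i x))\<^sup>2))"

text \<open>Indexing by finite sets of naturals loses no generality, since every finite family can be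
  reindexed in this way.\<close>

definition has_FSOS_supported_in ::
    "('a, 'm) monoid_scheme \<Rightarrow> ('a \<Rightarrow> complex) \<Rightarrow> ('a \<Rightarrow> complex) set \<Rightarrow> bool"
  where "has_FSOS_supported_in G g S \<longleftrightarrow>
    (\<exists>(I :: nat set) gs. is_FSOS G g I gs \<and> (\<forall>i\<in>I. fourier_supp G (gs i) \<subseteq> S))"

end

theory Submission
  imports Defs "HOL-Algebra.Multiplicative_Group"
begin

text \<open>
  Write \<open>s = sqrt f\<close>, and truncate its Fourier expansion to \<open>S\<close> to get \<open>h\<close>. The square of
  \<open>\<bar>h\<bar>\<close> is one admissible term, so it remains to write \<open>g + M\<close>, for
  \<open>g = f - \<bar>h\<bar>\<^sup>2 = \<bar>s\<bar>\<^sup>2 - \<bar>h\<bar>\<^sup>2\<close>, as a sum of squares supported in \<open>S\<close>.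

  Two descriptions of \<open>g\<close> are played against each other. The first, \<open>f - \<bar>h\<bar>\<^sup>2\<close>, controls the
  support: \<open>f\<close> is supported in \<open>S\<close>, \<open>\<bar>h\<bar>\<^sup>2 = cnj h * h\<close> is supported on quotients \<open>\<beta> / \<alpha>\<close> of
  elements of \<open>S\<close>, and the trivial character lies in \<open>S\<close> because the mean of \<open>f\<close> is
  positive; so every character in the support of \<open>g\<close> is such a quotient
  (\<open>fourier_supp_diff_cmod_square\<close>). The second, \<open>\<bar>s\<bar>\<^sup>2 - \<bar>h\<bar>\<^sup>2\<close>, controls the size: expanding
  both squares and cancelling shows that the \<open>\<ell>\<^sup>1\<close> norm of the Fourier transform of \<open>g\<close> is at
  most \<open>M\<close> (\<open>l1_norm_diff_cmod_square\<close>).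

  Since \<open>g\<close> is real, it is the sum of the real parts of \<open>c * \<beta> / \<alpha>\<close>, where \<open>c\<close> is the Fourier
  coefficient at \<open>\<beta> / \<alpha>\<close>. Adding the constant \<open>\<bar>c\<bar>\<close> to such a real part gives a square:
  \<open>\<bar>c\<bar> + Re (c * cnj \<alpha> * \<beta>) = (\<bar>c\<bar> / 2) * \<bar>\<alpha> + sgn c * \<beta>\<bar>\<^sup>2\<close>, as \<open>\<alpha>\<close> and \<open>\<beta>\<close> have modulus \<open>1\<close>.
  All these constants together cost at most \<open>M\<close>, and what is left over is a nonnegative
  multiple of the square of the trivial character (\<open>has_FSOS_square_plus_l1_norm\<close>).

  The Fourier coefficients are defined by unique existence, so the expansion itself has to be
  established. Uniqueness is orthogonality of characters. Existence follows from the
  simultaneous diagonalization of the translations \<open>x \<mapsto> a \<otimes> x\<close>: these commute and have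
  finite order, so every function is a sum of common eigenfunctions, and a common
  eigenfunction is a scalar multiple of a character (\<open>all_in_char_span\<close>).
\<close>

section \<open>Characters of a finite abelian group\<close>

locale finite_comm_group = comm_group +
  assumes finite_carrier: "finite (carrier G)"
begin

abbreviation dual :: "('a \<Rightarrow> complex) set"
  where "dual \<equiv> carrier (character_group G)"

lemma order_pos: "0 < order G"
  using finite_carrier by (simp add: order_gt_0_iff_finite)

lemma char_mult:
  "\<chi> \<in> dual \<Longrightarrow> x \<in> carrier G \<Longrightarrow> y \<in> carrier G \<Longrightarrow> \<chi> (x \<otimes> y) = \<chi> x * \<chi> y"
  by (simp add: character_group_def hom_def complex_units_def)

lemma char_nonzero: "\<chi> \<in> dual \<Longrightarrow> x \<in> carrier G \<Longrightarrow> \<chi> x \<noteq> 0"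
  by (auto simp: character_group_def hom_def complex_units_def)

lemma char_one: "\<chi> \<in> dual \<Longrightarrow> \<chi> \<one> = 1"
  using char_mult[of \<chi> \<one> \<one>] char_nonzero[of \<chi> \<one>] by simp

lemma char_pow:
  assumes "\<chi> \<in> dual" "x \<in> carrier G"
  shows "\<chi> (x [^] (k::nat)) = \<chi> x ^ k"
  using assms by (induction k) (auto simp: char_one char_mult)

lemma char_power_order:
  assumes "\<chi> \<in> dual" "x \<in> carrier G"
  shows "\<chi> x ^ order G = 1"
  using char_pow[OF assms, of "order G"] assms by (simp add: pow_order_eq_1 char_one)

lemma norm_char:
  assumes "\<chi> \<in> dual" "x \<in> carrier G"
  shows "cmod (\<chi> x) = 1"
proof -
  have "cmod (\<chi> x) ^ order G = 1"
    using char_power_order[OF assms] by (metis norm_one norm_power)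
  then show ?thesis
    using order_pos by (metis norm_ge_zero power_eq_imp_eq_base power_one zero_le_one)
qed

lemma cnj_char_mult_char: 
  assumes "\<chi> \<in> dual" "x \<in> carrier G"
  shows "cnj (\<chi> x) * \<chi> x = 1"
  using norm_char[OF assms] by (metis complex_norm_square mult.commute of_real_1 power_one)

lemma char_eqI:
  assumes "\<chi> \<in> dual" "\<psi> \<in> dual" "\<And>x. x \<in> carrier G \<Longrightarrow> \<chi> x = \<psi> x"
  shows "\<chi> = \<psi>"
  using assms by (auto simp: character_group_def intro: extensionalityI)

lemma dualI:
  assumes "\<chi> \<in> extensional (carrier G)" "\<And>x. x \<in> carrier G \<Longrightarrow> \<chi> x \<noteq> 0"
    and "\<And>x y. x \<in> carrier G \<Longrightarrow> y \<in> carrier G \<Longrightarrow> \<chi> (x \<otimes> y) = \<chi> x * \<chi> y"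
  shows "\<chi> \<in> dual"
  using assms by (auto simp: character_group_def hom_def complex_units_def)

lemma one_dual: "\<one>\<^bsub>character_group G\<^esub> \<in> dual"
  and one_dual_apply: "x \<in> carrier G \<Longrightarrow> \<one>\<^bsub>character_group G\<^esub> x = 1"
  by (auto intro!: dualI simp: character_group_def)
    (auto simp: hom_def complex_units_def)

lemma quotient_dual:
  assumes "\<alpha> \<in> dual" "\<beta> \<in> dual"
  shows "inv\<^bsub>character_group G\<^esub> \<alpha> \<otimes>\<^bsub>character_group G\<^esub> \<beta> \<in> dual"
proof -
  interpret D: comm_group "character_group G"
    by (rule comm_group_character_group[OF is_group])
  show ?thesis using assms by simp
qed

lemma quotient_dual_apply:
  assumes "\<alpha> \<in> dual" "\<beta> \<in> dual" "x \<in> carrier G"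
  shows "(inv\<^bsub>character_group G\<^esub> \<alpha> \<otimes>\<^bsub>character_group G\<^esub> \<beta>) x = cnj (\<alpha> x) * \<beta> x"
proof -
  interpret D: comm_group "character_group G"
    by (rule comm_group_character_group[OF is_group])
  have mult: "(\<phi> \<otimes>\<^bsub>character_group G\<^esub> \<psi>) x = \<phi> x * \<psi> x" for \<phi> \<psi>
    using assms(3) by (simp add: character_group_def)
  have "(inv\<^bsub>character_group G\<^esub> \<alpha>) x * \<alpha> x = 1"
    using mult D.l_inv[OF assms(1)] one_dual_apply[OF assms(3)] by metis
  then have "(inv\<^bsub>character_group G\<^esub> \<alpha>) x = cnj (\<alpha> x)"
    using cnj_char_mult_char[OF assms(1,3)] by (metis mult_cancel_right zero_neq_one mult_zero_right)
  then show ?thesis by (simp add: mult)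
qed

text \<open>The values of a character are roots of unity of order dividing \<open>order G\<close>.\<close>

lemma finite_dual: "finite dual"
proof (rule finite_subset)
  show "dual \<subseteq> (\<Pi>\<^sub>E x\<in>carrier G. {z. z ^ order G = 1})"
    using char_power_order
    by (auto simp: PiE_iff) (auto simp: character_group_def extensional_def)
  show "finite (\<Pi>\<^sub>E x\<in>carrier G. {z::complex. z ^ order G = 1})"
    using finite_carrier order_pos by (intro finite_PiE finite_roots_unity) auto
qed

text \<open>Substituting \<open>y \<otimes> x\<close> for \<open>x\<close> multiplies the sum by \<open>\<chi> y / \<psi> y\<close>, so it vanishes as soon as
  \<open>\<chi>\<close> and \<open>\<psi>\<close> differ at some \<open>y\<close>.\<close>

lemma char_orthogonal:
  assumes "\<chi> \<in> dual" "\<psi> \<in> dual"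
  shows "(\<Sum>x\<in>carrier G. \<chi> x * cnj (\<psi> x)) = (if \<chi> = \<psi> then of_nat (order G) else 0)"
proof (cases "\<chi> = \<psi>")
  case True
  then have "(\<Sum>x\<in>carrier G. \<chi> x * cnj (\<psi> x)) = (\<Sum>x\<in>carrier G. 1)"
    using cnj_char_mult_char[OF assms(2)] by (intro sum.cong) (auto simp: mult.commute)
  then show ?thesis using True by (simp add: order_def)
next
  case False
  define T where "T = (\<Sum>x\<in>carrier G. \<chi> x * cnj (\<psi> x))"
  obtain y where y: "y \<in> carrier G" "\<chi> y \<noteq> \<psi> y"
    using False char_eqI[OF assms] by blast
  have "T = (\<Sum>x\<in>carrier G. \<chi> (y \<otimes> x) * cnj (\<psi> (y \<otimes> x)))"
    unfolding T_def using y(1) by (intro sum.reindex_bij_betw[symmetric]) (simp add: bij_betw_def inj_on_cmult surj_const_mult)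
  also have "\<dots> = (\<chi> y * cnj (\<psi> y)) * T"
    unfolding T_def sum_distrib_left
    using y(1) assms by (intro sum.cong) (auto simp: char_mult mult_ac)
  finally have "\<psi> y * T = \<psi> y * ((\<chi> y * cnj (\<psi> y)) * T)" by (rule arg_cong)
  also have "\<dots> = (cnj (\<psi> y) * \<psi> y) * \<chi> y * T" by (simp add: mult_ac)
  also have "\<dots> = \<chi> y * T" by (simp add: cnj_char_mult_char[OF assms(2) y(1)])
  finally have "T = 0" using y(2) by simp
  then show ?thesis using False by (simp add: T_def)
qed

section \<open>Existence and uniqueness of the Fourier expansion\<close>

definition translation_eigen :: "'a \<Rightarrow> ('a \<Rightarrow> complex) \<Rightarrow> bool"
  where "translation_eigen a F \<longleftrightarrow> (\<exists>w. \<forall>x\<in>carrier G. F (a \<otimes> x) = w * F x)"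

definition in_char_span :: "('a \<Rightarrow> complex) \<Rightarrow> bool"
  where "in_char_span F \<longleftrightarrow> (\<exists>c. \<forall>x\<in>carrier G. F x = (\<Sum>\<chi>\<in>dual. c \<chi> * \<chi> x))"

lemma in_char_span_sum:
  assumes "finite J" "\<And>j. j \<in> J \<Longrightarrow> in_char_span (F j)"
    and "\<And>x. x \<in> carrier G \<Longrightarrow> H x = (\<Sum>j\<in>J. F j x)"
  shows "in_char_span H"
proof -
  have "\<forall>j\<in>J. \<exists>c. \<forall>x\<in>carrier G. F j x = (\<Sum>\<chi>\<in>dual. c \<chi> * \<chi> x)"
    using assms(2) by (simp add: in_char_span_def)
  then obtain c where c: "\<And>j x. j \<in> J \<Longrightarrow> x \<in> carrier G \<Longrightarrow> F j x = (\<Sum>\<chi>\<in>dual. c j \<chi> * \<chi> x)"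
    by metis
  have "H x = (\<Sum>\<chi>\<in>dual. (\<Sum>j\<in>J. c j \<chi>) * \<chi> x)" if "x \<in> carrier G" for x
    using that assms(3) c by (simp add: sum_distrib_right sum.swap[of _ dual J])
  then show ?thesis unfolding in_char_span_def by (intro exI[of _ "\<lambda>\<chi>. \<Sum>j\<in>J. c j \<chi>"]) simp
qed

text \<open>A common eigenfunction satisfies \<open>F x = w x * F \<one>\<close>, where \<open>w x\<close> is the eigenvalue of the
  translation by \<open>x\<close>. If \<open>F \<one> \<noteq> 0\<close>, this makes \<open>w\<close> multiplicative, hence a character.\<close>

lemma eigen_in_char_span:
  assumes "\<And>a. a \<in> carrier G \<Longrightarrow> translation_eigen a F"
  shows "in_char_span F"
proof -
  obtain w where w: "\<And>a x. a \<in> carrier G \<Longrightarrow> x \<in> carrier G \<Longrightarrow> F (a \<otimes> x) = w a * F x"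
    using assms unfolding translation_eigen_def by metis
  have F: "F x = w x * F \<one>" if "x \<in> carrier G" for x
    using w[OF that one_closed] that by simp
  show ?thesis
  proof (cases "F \<one> = 0")
    case True
    then have "F x = 0" if "x \<in> carrier G" for x
      using F[OF that] by simp
    then show ?thesis
      unfolding in_char_span_def by (intro exI[of _ "\<lambda>_. 0"]) simp
  next
    case False
    define \<psi> where "\<psi> = restrict w (carrier G)"
    have w_mult: "w (x \<otimes> y) = w x * w y" if "x \<in> carrier G" "y \<in> carrier G" for x y
      using that w[of x y] F[of y] F[of "x \<otimes> y"] False by simp
    have "w \<one> = 1" using F[of \<one>] False by simp
    then have w_nz: "w x \<noteq> 0" if "x \<in> carrier G" for x
      using w_mult[of "inv x" x] that by auto
    have "\<psi> \<in> dual"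
      by (rule dualI) (auto simp: \<psi>_def w_mult w_nz)
    have "F x = (\<Sum>\<chi>\<in>dual. (if \<chi> = \<psi> then F \<one> else 0) * \<chi> x)"
      if x: "x \<in> carrier G" for x
    proof -
      have "F x = F \<one> * \<psi> x"
        using x by (subst F) (simp_all add: \<psi>_def)
      also have "\<dots> = (\<Sum>\<chi>\<in>dual. if \<chi> = \<psi> then F \<one> * \<psi> x else 0)"
        using \<open>\<psi> \<in> dual\<close> finite_dual by simp
      also have "\<dots> = (\<Sum>\<chi>\<in>dual. (if \<chi> = \<psi> then F \<one> else 0) * \<chi> x)"
        by (intro sum.cong) auto
      finally show ?thesis .
    qed
    then show ?thesis
      unfolding in_char_span_def by (intro exI[of _ "\<lambda>\<chi>. if \<chi> = \<psi> then F \<one> else 0"]) blast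
  qed
qed

text \<open>The translation \<open>T\<close> by \<open>a\<close> satisfies \<open>T\<^sup>n = 1\<close> for \<open>n = order G\<close>. With \<open>\<zeta>\<close> a primitive \<open>n\<close>-th
  root of unity, the averages of \<open>\<zeta>\<^sup>j\<^sup>k T\<^sup>k\<close> over \<open>k\<close> are the projections onto the eigenspaces of \<open>T\<close>.
  They sum to the identity, and they preserve the eigenfunctions of all other translations
  because translations commute.\<close>

lemma translation_decomposition:
  assumes a: "a \<in> carrier G"
  obtains P :: "nat \<Rightarrow> 'a \<Rightarrow> complex"
  where "\<And>j. translation_eigen a (P j)"
    and "\<And>j b. b \<in> carrier G \<Longrightarrow> translation_eigen b F \<Longrightarrow> translation_eigen b (P j)"
    and "\<And>x. x \<in> carrier G \<Longrightarrow> F x = (\<Sum>j<order G. P j x)"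
proof
  define n where "n = order G"
  have n: "0 < n" using order_pos by (simp add: n_def)
  define \<zeta> where "\<zeta> = cis (2 * pi / n)"
  have zpow: "\<zeta> ^ k = cis (2 * pi * k / n)" for k
    by (simp add: \<zeta>_def DeMoivre mult_ac)
  have zn: "\<zeta> ^ n = 1" using n by (simp add: zpow)
  have zne: "\<zeta> ^ k \<noteq> 1" if "0 < k" "k < n" for k
  proof -
    have "inj_on (\<lambda>k. cis (2 * pi * real k / real n)) {..<n}"
      using bij_betw_roots_unity[OF n] by (simp add: bij_betw_def)
    from inj_onD[OF this, of k 0] that show ?thesis by (auto simp: zpow)
  qed
  define P where "P = (\<lambda>j x. (\<Sum>k<n. (\<zeta> ^ j) ^ k * F (a [^] k \<otimes> x)) / n)"
  show "translation_eigen a (P j)" for j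
  proof -
    define z where "z = \<zeta> ^ j"
    have z: "z ^ n = 1" "z \<noteq> 0"
      using zn by (auto simp: z_def \<zeta>_def power_mult[symmetric] mult.commute) (metis power_mult power_one mult.commute)
    have "P j (a \<otimes> x) = inverse z * P j x" if x: "x \<in> carrier G" for x
    proof -
      define t where "t = (\<lambda>k. z ^ k * F (a [^] k \<otimes> x))"
      have an: "a [^] n = \<one>" using a by (simp add: n_def pow_order_eq_1)
      have "(\<Sum>k<n. t (Suc k)) = (\<Sum>k<n. t k)"
        using sum.lessThan_Suc_shift[of t n] z(1) an by (simp add: t_def)
      moreover have "t (Suc k) = z * (z ^ k * F (a [^] k \<otimes> (a \<otimes> x)))" for k
        using a x by (simp add: t_def m_assoc)
      ultimately have "z * (\<Sum>k<n. z ^ k * F (a [^] k \<otimes> (a \<otimes> x))) = (\<Sum>k<n. t k)"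
        by (simp add: sum_distrib_left)
      then show ?thesis
        using z(2) n by (simp add: P_def z_def[symmetric] t_def) (simp add: field_simps)
    qed
    then show ?thesis by (auto simp: translation_eigen_def)
  qed
  show "translation_eigen b (P j)" if b: "b \<in> carrier G" "translation_eigen b F" for j b
  proof -
    obtain w where w: "\<And>x. x \<in> carrier G \<Longrightarrow> F (b \<otimes> x) = w * F x"
      using b(2) by (auto simp: translation_eigen_def)
    have "P j (b \<otimes> x) = w * P j x" if x: "x \<in> carrier G" for x
    proof -
      have "F (a [^] k \<otimes> (b \<otimes> x)) = w * F (a [^] k \<otimes> x)" for k :: nat
        using w[of "a [^] k \<otimes> x"] a b x by (simp add: m_lcomm)
      then show ?thesis by (simp add: P_def sum_distrib_left mult_ac)
    qed
    then show ?thesis by (auto simp: translation_eigen_def)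
  qed
  show "F x = (\<Sum>j<order G. P j x)" if x: "x \<in> carrier G" for x
  proof -
    \<comment> \<open>Summed over \<open>j\<close>, only the term \<open>k = 0\<close> of the projections survives.\<close>
    have geo: "(\<Sum>j<n. (\<zeta> ^ j) ^ k) = (if k = 0 then of_nat n else 0)" if "k < n" for k
    proof (cases "k = 0")
      case False
      have "(\<Sum>j<n. (\<zeta> ^ j) ^ k) = (\<Sum>j<n. (\<zeta> ^ k) ^ j)"
        by (simp add: power_mult[symmetric] mult.commute)
      also have "\<dots> = ((\<zeta> ^ k) ^ n - 1) / (\<zeta> ^ k - 1)"
        using zne[of k] False that by (intro geometric_sum) auto
      also have "(\<zeta> ^ k) ^ n = 1" using zn by (metis power_mult power_one mult.commute)
      finally show ?thesis using False by simp
    qed simp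
    have "(\<Sum>j<n. P j x) = (\<Sum>k<n. (\<Sum>j<n. (\<zeta> ^ j) ^ k) * F (a [^] k \<otimes> x)) / n"
      unfolding P_def sum_divide_distrib[symmetric] sum_distrib_right by (subst sum.swap) simp
    also have "(\<Sum>k<n. (\<Sum>j<n. (\<zeta> ^ j) ^ k) * F (a [^] k \<otimes> x)) = (\<Sum>k<n. if k = 0 then of_nat n * F x else 0)"
      using x by (intro sum.cong) (auto simp: geo)
    also have "\<dots> = of_nat n * F x" using n by simp
    finally show ?thesis using n by (simp add: n_def)
  qed
qed

lemma all_in_char_span: "in_char_span F"
proof -
  \<comment> \<open>Induction on the set \<open>A\<close> of translations for which \<open>F\<close> is not yet known to be an
    eigenfunction: projecting onto the eigenspaces of one of them takes it out of \<open>A\<close>.\<close>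
  have "in_char_span F"
    if "finite A" "A \<subseteq> carrier G" "\<And>b. b \<in> carrier G - A \<Longrightarrow> translation_eigen b F" for A
    using that
  proof (induction A arbitrary: F rule: finite_induct)
    case empty
    then show ?case by (auto intro: eigen_in_char_span)
  next
    case (insert a A)
    from insert.prems have a: "a \<in> carrier G" by simp
    obtain P :: "nat \<Rightarrow> 'a \<Rightarrow> complex" where P: "\<And>j. translation_eigen a (P j)"
      "\<And>j b. b \<in> carrier G \<Longrightarrow> translation_eigen b F \<Longrightarrow> translation_eigen b (P j)"
      "\<And>x. x \<in> carrier G \<Longrightarrow> F x = (\<Sum>j<order G. P j x)"
      using translation_decomposition[OF a, of F] by blast
    have "in_char_span (P j)" for j
    proof (rule insert.IH)
      show "translation_eigen b (P j)" if "b \<in> carrier G - A" for b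
        using that insert.prems(2)[of b] P(1,2) by (cases "b = a") auto
    qed (use insert.prems(1) in auto)
    then show ?case by (rule in_char_span_sum[OF finite_lessThan _ P(3)])
  qed
  from this[OF finite_carrier] show ?thesis by auto
qed

lemma coefficient_eq:
  assumes "\<And>x. x \<in> carrier G \<Longrightarrow> F x = (\<Sum>\<chi>\<in>dual. c \<chi> * \<chi> x)" and \<psi>: "\<psi> \<in> dual"
  shows "c \<psi> = (\<Sum>x\<in>carrier G. F x * cnj (\<psi> x)) / of_nat (order G)"
proof -
  have "(\<Sum>x\<in>carrier G. F x * cnj (\<psi> x)) = (\<Sum>\<chi>\<in>dual. c \<chi> * (\<Sum>x\<in>carrier G. \<chi> x * cnj (\<psi> x)))"
    using assms(1)
    by (simp add: sum_distrib_left sum_distrib_right mult_ac sum.swap[of _ dual "carrier G"])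
  also have "\<dots> = (\<Sum>\<chi>\<in>dual. if \<chi> = \<psi> then c \<psi> * of_nat (order G) else 0)"
    using \<psi> by (intro sum.cong) (auto simp: char_orthogonal)
  also have "\<dots> = c \<psi> * of_nat (order G)" using finite_dual \<psi> by simp
  finally show ?thesis using order_pos by simp
qed

lemma fourier_expansion:
  assumes "x \<in> carrier G"
  shows "F x = (\<Sum>\<chi>\<in>dual. fourier G F \<chi> * \<chi> x)"
proof -
  obtain c where c: "\<And>x. x \<in> carrier G \<Longrightarrow> F x = (\<Sum>\<chi>\<in>dual. c \<chi> * \<chi> x)"
    using all_in_char_span[of F] unfolding in_char_span_def by blast
  let ?Q = "\<lambda>c. c \<in> extensional dual \<and> (\<forall>x\<in>carrier G. F x = (\<Sum>\<chi>\<in>dual. c \<chi> * \<chi> x))"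
  have "?Q (fourier G F)"
    unfolding fourier_def
  proof (rule theI[where P = ?Q])
    show "?Q (restrict c dual)" using c by simp
    show "d = restrict c dual" if d: "?Q d" for d
    proof (rule extensionalityI[of _ dual])
      fix \<psi> assume \<psi>: "\<psi> \<in> dual"
      have "d \<psi> = (\<Sum>x\<in>carrier G. F x * cnj (\<psi> x)) / of_nat (order G)"
        using d by (intro coefficient_eq[OF _ \<psi>]) blast
      also have "\<dots> = c \<psi>"
        using c by (intro coefficient_eq[OF _ \<psi>, symmetric])
      finally show "d \<psi> = restrict c dual \<psi>" using \<psi> by simp
    qed (use d in auto)
  qed
  then have "\<forall>x\<in>carrier G. F x = (\<Sum>\<chi>\<in>dual. fourier G F \<chi> * \<chi> x)" by (rule conjunct2)
  then show ?thesis using assms by (rule bspec)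
qed

lemma fourier_eq:
  "\<psi> \<in> dual \<Longrightarrow> fourier G F \<psi> = (\<Sum>x\<in>carrier G. F x * cnj (\<psi> x)) / of_nat (order G)"
  by (rule coefficient_eq[where c = "fourier G F"]) (rule fourier_expansion)

lemma fourier_diff:
  "\<psi> \<in> dual \<Longrightarrow> fourier G (\<lambda>x. F x - H x) \<psi> = fourier G F \<psi> - fourier G H \<psi>"
  by (simp add: fourier_eq left_diff_distrib sum_subtractf diff_divide_distrib)

text \<open>The characters \<open>p i\<close> may repeat. This makes the lemma applicable to products of expansions,
  where a pair \<open>(\<alpha>, \<beta>)\<close> contributes to the coefficient of a product or quotient of \<open>\<alpha>\<close> and \<open>\<beta>\<close>;
  it yields the bounds below on support and norm without a convolution formula.\<close>

lemma fourier_combination: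
  assumes "finite I" "\<And>i. i \<in> I \<Longrightarrow> p i \<in> dual"
    and F: "\<And>x. x \<in> carrier G \<Longrightarrow> F x = (\<Sum>i\<in>I. a i * p i x)"
    and \<chi>: "\<chi> \<in> dual"
  shows "fourier G F \<chi> = (\<Sum>i\<in>{i\<in>I. p i = \<chi>}. a i)"
proof -
  have "F x = (\<Sum>\<psi>\<in>dual. (\<Sum>i\<in>{i\<in>I. p i = \<psi>}. a i) * \<psi> x)" if "x \<in> carrier G" for x
  proof -
    have "F x = (\<Sum>\<psi>\<in>dual. \<Sum>i\<in>{i\<in>I. p i = \<psi>}. a i * p i x)"
      using F[OF that] assms(1,2) finite_dual by (subst sum.group) auto
    then show ?thesis by (simp add: sum_distrib_right)
  qed
  from coefficient_eq[OF this \<chi>] show ?thesis using fourier_eq[OF \<chi>, of F] by simp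
qed

lemma fourier_supp_combination:
  assumes "finite I" "\<And>i. i \<in> I \<Longrightarrow> p i \<in> dual"
    and "\<And>x. x \<in> carrier G \<Longrightarrow> F x = (\<Sum>i\<in>I. a i * p i x)"
  shows "fourier_supp G F \<subseteq> p ` I"
proof
  fix \<chi> assume "\<chi> \<in> fourier_supp G F"
  then have "\<chi> \<in> dual" "(\<Sum>i\<in>{i\<in>I. p i = \<chi>}. a i) \<noteq> 0"
    using fourier_combination[OF assms] by (auto simp: fourier_supp_def)
  then show "\<chi> \<in> p ` I" by (metis (mono_tags, lifting) imageI mem_Collect_eq sum.neutral)
qed

lemma l1_norm_combination:
  assumes "finite I" "\<And>i. i \<in> I \<Longrightarrow> p i \<in> dual"
    and "\<And>x. x \<in> carrier G \<Longrightarrow> F x = (\<Sum>i\<in>I. a i * p i x)"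
  shows "l1_norm G (fourier G F) \<le> (\<Sum>i\<in>I. cmod (a i))"
proof -
  have "l1_norm G (fourier G F) \<le> (\<Sum>\<chi>\<in>dual. \<Sum>i\<in>{i\<in>I. p i = \<chi>}. cmod (a i))"
    unfolding l1_norm_def
    by (intro sum_mono) (simp add: fourier_combination[OF assms] norm_sum)
  also have "\<dots> = (\<Sum>i\<in>I. cmod (a i))"
    using assms(1,2) finite_dual by (intro sum.group) auto
  finally show ?thesis .
qed

end

section \<open>Building sums of squares\<close>

lemma has_FSOS_supported_inI:
  assumes "finite I" "\<And>i. i \<in> I \<Longrightarrow> fourier_supp G (gs i) \<subseteq> S"
    and "\<And>x. x \<in> carrier G \<Longrightarrow> g x = complex_of_real (\<Sum>i\<in>I. (cmod (gs i x))\<^sup>2)"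
  shows "has_FSOS_supported_in G g S"
proof -
  obtain e where e: "bij_betw e {..<card I} I"
    using ex_bij_betw_nat_finite[OF assms(1)] by (auto simp: atLeast0LessThan)
  have "is_FSOS G g {..<card I} (gs \<circ> e)"
    using assms(3) by (simp add: is_FSOS_def sum.reindex_bij_betw[OF e, of "\<lambda>i. (cmod (gs i _))\<^sup>2"])
  moreover have "\<forall>i\<in>{..<card I}. fourier_supp G ((gs \<circ> e) i) \<subseteq> S"
    using assms(2) bij_betwE[OF e] by simp
  ultimately show ?thesis unfolding has_FSOS_supported_in_def by blast
qed

text \<open>For unit vectors \<open>u\<close> and \<open>w = sgn c * v\<close>, the square of \<open>\<bar>u + w\<bar>\<close> is \<open>2 + 2 * Re (cnj u * w)\<close>;
  this is scaled by \<open>\<bar>c\<bar> / 2\<close>. If \<open>c = 0\<close>, then \<open>sgn c = 0\<close> and both sides vanish.\<close>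

lemma cmod_plus_Re_eq_square:
  fixes u v c :: complex
  assumes "cmod u = 1" "cmod v = 1"
  shows "(cmod (of_real (sqrt (cmod c / 2)) * (u + sgn c * v)))\<^sup>2 = cmod c + Re (c * (cnj u * v))"
proof (cases "c = 0")
  case False
  have "(cmod (u + w))\<^sup>2 = (cmod u)\<^sup>2 + (cmod w)\<^sup>2 + 2 * Re (cnj u * w)" for w
    unfolding cmod_power2 by (simp add: power2_eq_square algebra_simps)
  then have "(cmod (u + sgn c * v))\<^sup>2 = (cmod u)\<^sup>2 + (cmod (sgn c * v))\<^sup>2 + 2 * Re (cnj u * (sgn c * v))" .
  also have "\<dots> = 2 + 2 * Re (cnj u * (sgn c * v))"
    using assms False by (simp add: norm_mult norm_sgn)
  also have "Re (cnj u * (sgn c * v)) = Re (c * (cnj u * v)) / cmod c"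
    by (simp add: sgn_div_norm scaleR_conv_of_real field_simps)
  finally have "(cmod (u + sgn c * v))\<^sup>2 = 2 + 2 * (Re (c * (cnj u * v)) / cmod c)" .
  moreover have "(cmod (of_real (sqrt (cmod c / 2)) * (u + sgn c * v)))\<^sup>2
      = cmod c / 2 * (cmod (u + sgn c * v))\<^sup>2"
    by (simp only: norm_mult power_mult_distrib norm_of_real) simp
  ultimately show ?thesis using False by (simp only:) (simp add: distrib_left)
qed simp

context finite_comm_group
begin

text \<open>Each character in the support of \<open>g\<close> is completed to a square at the cost of the modulus of its
  coefficient, which adds up to the \<open>\<ell>\<^sup>1\<close> norm. The two further terms of the sum of squares are
  \<open>h\<close> and the constant function that absorbs the slack in the bound by \<open>M\<close>.\<close>

lemma has_FSOS_square_plus_l1_norm: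
  fixes g :: "'a \<Rightarrow> real"
  assumes S: "S \<subseteq> dual" "\<one>\<^bsub>character_group G\<^esub> \<in> S"
    and h: "fourier_supp G h \<subseteq> S"
    and supp: "\<And>\<chi>. \<chi> \<in> fourier_supp G (\<lambda>x. of_real (g x)) \<Longrightarrow>
      \<exists>\<alpha>\<in>S. \<exists>\<beta>\<in>S. \<chi> = inv\<^bsub>character_group G\<^esub> \<alpha> \<otimes>\<^bsub>character_group G\<^esub> \<beta>"
    and M: "l1_norm G (fourier G (\<lambda>x. of_real (g x))) \<le> M"
  shows "has_FSOS_supported_in G (\<lambda>x. of_real ((cmod (h x))\<^sup>2 + g x + M)) S"
proof -
  let ?c = "fourier G (\<lambda>x. of_real (g x))"
  define T where "T = fourier_supp G (\<lambda>x. of_real (g x))"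
  have T: "finite T" "T \<subseteq> dual" using finite_dual by (auto simp: T_def fourier_supp_def)
  obtain \<alpha> \<beta> where ab: "\<And>\<chi>. \<chi> \<in> T \<Longrightarrow> \<alpha> \<chi> \<in> S" "\<And>\<chi>. \<chi> \<in> T \<Longrightarrow> \<beta> \<chi> \<in> S"
    "\<And>\<chi>. \<chi> \<in> T \<Longrightarrow> \<chi> = inv\<^bsub>character_group G\<^esub> (\<alpha> \<chi>) \<otimes>\<^bsub>character_group G\<^esub> (\<beta> \<chi>)"
    using supp unfolding T_def by metis
  define L where "L = l1_norm G ?c"
  have L: "L = (\<Sum>\<chi>\<in>T. cmod (?c \<chi>))"
    unfolding L_def l1_norm_def T_def fourier_supp_def using finite_dual by (intro sum.mono_neutral_right) auto
  define gs :: "(('a \<Rightarrow> complex) + bool) \<Rightarrow> 'a \<Rightarrow> complex" where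
    "gs = case_sum (\<lambda>\<chi> x. of_real (sqrt (cmod (?c \<chi>) / 2)) * (\<alpha> \<chi> x + sgn (?c \<chi>) * \<beta> \<chi> x))
       (\<lambda>b x. if b then h x else of_real (sqrt (M - L)) * \<one>\<^bsub>character_group G\<^esub> x)"
  show ?thesis
  proof (rule has_FSOS_supported_inI[of "Sum_Type.Plus T UNIV" _ gs])
    show "finite (Sum_Type.Plus T (UNIV :: bool set))" using T by simp
  next
    fix i assume i: "i \<in> Sum_Type.Plus T (UNIV :: bool set)"
    show "fourier_supp G (gs i) \<subseteq> S"
    proof (cases i)
      case (Inl \<chi>)
      let ?k = "complex_of_real (sqrt (cmod (?c \<chi>) / 2))"
      have "\<chi> \<in> T" using i Inl by auto
      then have "fourier_supp G (gs i) \<subseteq> (\<lambda>b. if b then \<alpha> \<chi> else \<beta> \<chi>) ` UNIV"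
        using ab(1,2)[of \<chi>] S(1)
        by (intro fourier_supp_combination[where a = "\<lambda>b. if b then ?k else ?k * sgn (?c \<chi>)"])
          (auto simp: gs_def Inl UNIV_bool algebra_simps split: if_splits)
      then show ?thesis using ab(1,2)[OF \<open>\<chi> \<in> T\<close>] by auto
    next
      case (Inr b)
      have "fourier_supp G (\<lambda>x. of_real (sqrt (M - L)) * \<one>\<^bsub>character_group G\<^esub> x)
          \<subseteq> (\<lambda>_. \<one>\<^bsub>character_group G\<^esub>) ` {()}"
        using one_dual by (intro fourier_supp_combination[where a = "\<lambda>_. of_real (sqrt (M - L))"]) auto
      then show ?thesis using h S(2) by (cases b) (auto simp: gs_def Inr)
    qed
  next
    fix x assume x: "x \<in> carrier G"
    have "(cmod (gs (Inl \<chi>) x))\<^sup>2 = cmod (?c \<chi>) + Re (?c \<chi> * \<chi> x)" if "\<chi> \<in> T" for \<chi>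
    proof -
      have d: "\<alpha> \<chi> \<in> dual" "\<beta> \<chi> \<in> dual" using ab(1,2)[OF that] S(1) by auto
      have "\<chi> x = cnj (\<alpha> \<chi> x) * \<beta> \<chi> x"
        using quotient_dual_apply[OF d x] ab(3)[OF that] by simp
      then show ?thesis
        using cmod_plus_Re_eq_square[of "\<alpha> \<chi> x" "\<beta> \<chi> x" "?c \<chi>"] norm_char d x
        by (simp add: gs_def)
    qed
    then have 1: "(\<Sum>\<chi>\<in>T. (cmod (gs (Inl \<chi>) x))\<^sup>2) = L + Re (\<Sum>\<chi>\<in>T. ?c \<chi> * \<chi> x)"
      by (simp add: sum.distrib L)
    have "complex_of_real (g x) = (\<Sum>\<chi>\<in>dual. ?c \<chi> * \<chi> x)"
      by (rule fourier_expansion[OF x])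
    also have "\<dots> = (\<Sum>\<chi>\<in>T. ?c \<chi> * \<chi> x)"
      unfolding T_def fourier_supp_def using finite_dual by (intro sum.mono_neutral_right) auto
    finally have 2: "Re (\<Sum>\<chi>\<in>T. ?c \<chi> * \<chi> x) = g x" by (metis Re_complex_of_real)
    have 3: "(\<Sum>b\<in>UNIV. (cmod (gs (Inr b) x))\<^sup>2) = (cmod (h x))\<^sup>2 + (M - L)"
      using M by (simp add: UNIV_bool gs_def one_dual_apply[OF x] L_def)
    show "complex_of_real ((cmod (h x))\<^sup>2 + g x + M)
        = complex_of_real (\<Sum>i\<in>Sum_Type.Plus T UNIV. (cmod (gs i x))\<^sup>2)"
      using T by (simp only: sum.Plus finite_class.finite_UNIV comp_def 1 2 3) simp
  qed
qed

section \<open>The difference between a square and its truncation\<close>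

lemma cmod_square_expansion:
  assumes "x \<in> carrier G" and F: "F x = (\<Sum>\<chi>\<in>T. c \<chi> * \<chi> x)" and "T \<subseteq> dual"
  shows "complex_of_real ((cmod (F x))\<^sup>2) = (\<Sum>(\<alpha>, \<beta>)\<in>T \<times> T.
    (cnj (c \<alpha>) * c \<beta>) * (inv\<^bsub>character_group G\<^esub> \<alpha> \<otimes>\<^bsub>character_group G\<^esub> \<beta>) x)"
proof -
  have "complex_of_real ((cmod (F x))\<^sup>2) = cnj (F x) * F x"
    by (simp only: complex_norm_square mult.commute)
  also have "\<dots> = (\<Sum>\<alpha>\<in>T. \<Sum>\<beta>\<in>T. (cnj (c \<alpha>) * cnj (\<alpha> x)) * (c \<beta> * \<beta> x))"
    by (simp add: F sum_product)
  also have "\<dots> = (\<Sum>\<alpha>\<in>T. \<Sum>\<beta>\<in>T.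
      (cnj (c \<alpha>) * c \<beta>) * (inv\<^bsub>character_group G\<^esub> \<alpha> \<otimes>\<^bsub>character_group G\<^esub> \<beta>) x)"
    using assms by (intro sum.cong) (auto simp: quotient_dual_apply subset_iff mult_ac)
  finally show ?thesis by (simp add: sum.cartesian_product)
qed

text \<open>If \<open>u\<close>, \<open>v\<close> are the Fourier transforms of \<open>s\<close>, \<open>h\<close> and \<open>d = u - v\<close>, then the coefficient of
  the pair \<open>(\<alpha>, \<beta>)\<close> is \<open>cnj (u \<alpha>) * u \<beta> - cnj (v \<alpha>) * v \<beta>\<close>. Substituting \<open>u = v + d\<close> cancels the
  part without \<open>d\<close>, and the three remaining products give the three terms of the bound.\<close>

lemma l1_norm_diff_cmod_square:
  fixes s h :: "'a \<Rightarrow> complex"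
  defines "e \<equiv> l1_norm G (\<lambda>\<chi>. fourier G s \<chi> - fourier G h \<chi>)"
  shows "l1_norm G (fourier G (\<lambda>x. of_real ((cmod (s x))\<^sup>2 - (cmod (h x))\<^sup>2)))
    \<le> 2 * e * l1_norm G (fourier G h) + e\<^sup>2"
proof -
  define u where "u = fourier G s"
  define v where "v = fourier G h"
  define d where "d = (\<lambda>\<chi>. u \<chi> - v \<chi>)"
  let ?D = "dual \<times> dual"
  define a where "a = (\<lambda>(\<alpha>, \<beta>). cnj (u \<alpha>) * u \<beta> - cnj (v \<alpha>) * v \<beta>)"
  define p where "p = (\<lambda>(\<alpha>, \<beta>). inv\<^bsub>character_group G\<^esub> \<alpha> \<otimes>\<^bsub>character_group G\<^esub> \<beta>)"
  have "l1_norm G (fourier G (\<lambda>x. of_real ((cmod (s x))\<^sup>2 - (cmod (h x))\<^sup>2)))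
      \<le> (\<Sum>i\<in>?D. cmod (a i))"
  proof (rule l1_norm_combination[where p = p])
    show "complex_of_real ((cmod (s x))\<^sup>2 - (cmod (h x))\<^sup>2) = (\<Sum>i\<in>?D. a i * p i x)"
      if "x \<in> carrier G" for x
      using cmod_square_expansion[where F = s and c = u, OF that _ subset_refl]
        cmod_square_expansion[where F = h and c = v, OF that _ subset_refl]
        fourier_expansion[OF that, of s] fourier_expansion[OF that, of h]
      by (simp add: u_def v_def a_def p_def sum_subtractf[symmetric] left_diff_distrib split_def)
  qed (use finite_dual in \<open>auto simp: p_def quotient_dual\<close>)
  also have "\<dots> \<le> (\<Sum>(\<alpha>, \<beta>)\<in>?D. cmod (v \<alpha>) * cmod (d \<beta>) + cmod (d \<alpha>) * cmod (v \<beta>)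
      + cmod (d \<alpha>) * cmod (d \<beta>))"
  proof (intro sum_mono, clarify)
    fix \<alpha> \<beta>
    have "a (\<alpha>, \<beta>) = cnj (v \<alpha>) * d \<beta> + cnj (d \<alpha>) * v \<beta> + cnj (d \<alpha>) * d \<beta>"
      by (simp add: a_def d_def algebra_simps)
    also have "cmod \<dots> \<le> cmod (cnj (v \<alpha>) * d \<beta>) + cmod (cnj (d \<alpha>) * v \<beta>) + cmod (cnj (d \<alpha>) * d \<beta>)"
      by (metis norm_triangle_ineq norm_triangle_mono order_refl)
    finally show "cmod (a (\<alpha>, \<beta>)) \<le> cmod (v \<alpha>) * cmod (d \<beta>) + cmod (d \<alpha>) * cmod (v \<beta>)
      + cmod (d \<alpha>) * cmod (d \<beta>)" by (simp add: norm_mult)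
  qed
  also have "\<dots> = 2 * e * l1_norm G v + e\<^sup>2"
    by (simp add: sum.cartesian_product[symmetric] sum.distrib sum_product[symmetric]
        e_def l1_norm_def d_def u_def v_def power2_eq_square)
  finally show ?thesis by (simp add: v_def)
qed

text \<open>The coefficient at the trivial character is the mean value.\<close>

lemma one_in_fourier_supp:
  fixes f :: "'a \<Rightarrow> real"
  assumes "\<forall>x\<in>carrier G. f x \<ge> 0" "\<exists>x\<in>carrier G. f x \<noteq> 0"
  shows "\<one>\<^bsub>character_group G\<^esub> \<in> fourier_supp G (\<lambda>x. complex_of_real (f x))"
proof -
  have "(\<Sum>x\<in>carrier G. f x) \<noteq> 0"
    using assms finite_carrier by (simp add: sum_nonneg_eq_0_iff)
  moreover have "fourier G (\<lambda>x. complex_of_real (f x)) \<one>\<^bsub>character_group G\<^esub>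
      = of_real (\<Sum>x\<in>carrier G. f x) / of_nat (order G)"
    by (simp add: fourier_eq[OF one_dual] one_dual_apply)
  ultimately show ?thesis
    using one_dual order_pos by (simp add: fourier_supp_def del: of_real_sum)
qed

text \<open>The trivial character is needed to write an element \<open>\<chi>\<close> of \<open>S\<close> itself as a quotient.\<close>

lemma fourier_supp_diff_cmod_square:
  assumes S: "S \<subseteq> dual" "\<one>\<^bsub>character_group G\<^esub> \<in> S"
    and f: "fourier_supp G F \<subseteq> S" and h: "fourier_supp G h \<subseteq> S"
    and \<chi>: "\<chi> \<in> fourier_supp G (\<lambda>x. F x - of_real ((cmod (h x))\<^sup>2))"
  shows "\<exists>\<alpha>\<in>S. \<exists>\<beta>\<in>S. \<chi> = inv\<^bsub>character_group G\<^esub> \<alpha> \<otimes>\<^bsub>character_group G\<^esub> \<beta>"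
proof -
  interpret D: comm_group "character_group G"
    by (rule comm_group_character_group[OF is_group])
  have "\<chi> \<in> dual" using \<chi> by (simp add: fourier_supp_def)
  with \<chi> have "\<chi> \<in> fourier_supp G F \<or> \<chi> \<in> fourier_supp G (\<lambda>x. of_real ((cmod (h x))\<^sup>2))"
    by (auto simp: fourier_supp_def fourier_diff simp del: of_real_power)
  then show ?thesis
  proof
    assume "\<chi> \<in> fourier_supp G F"
    then show ?thesis using f S(2) \<open>\<chi> \<in> dual\<close> by (intro bexI[of _ "\<one>\<^bsub>character_group G\<^esub>"] bexI[of _ \<chi>]) auto
  next
    assume *: "\<chi> \<in> fourier_supp G (\<lambda>x. of_real ((cmod (h x))\<^sup>2))"
    have "h x = (\<Sum>\<chi>\<in>S. fourier G h \<chi> * \<chi> x)" if "x \<in> carrier G" for x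
      using fourier_expansion[OF that, of h] h S(1) finite_dual
      by (simp, intro sum.mono_neutral_right) (auto simp: fourier_supp_def)
    then have "complex_of_real ((cmod (h x))\<^sup>2) = (\<Sum>(\<alpha>, \<beta>)\<in>S \<times> S.
        (cnj (fourier G h \<alpha>) * fourier G h \<beta>) * (inv\<^bsub>character_group G\<^esub> \<alpha> \<otimes>\<^bsub>character_group G\<^esub> \<beta>) x)"
      if "x \<in> carrier G" for x
      using cmod_square_expansion[OF that _ S(1)] that by blast
    then have "fourier_supp G (\<lambda>x. of_real ((cmod (h x))\<^sup>2))
        \<subseteq> (\<lambda>(\<alpha>, \<beta>). inv\<^bsub>character_group G\<^esub> \<alpha> \<otimes>\<^bsub>character_group G\<^esub> \<beta>) ` (S \<times> S)"
      using S(1) finite_subset[OF S(1) finite_dual]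
      by (intro fourier_supp_combination[where a = "\<lambda>(\<alpha>, \<beta>). cnj (fourier G h \<alpha>) * fourier G h \<beta>"])
        (auto simp: split_def quotient_dual subset_iff simp del: of_real_power)
    from subsetD[OF this *] show ?thesis by auto
  qed
qed

end

theorem theorem5p4:
  fixes G :: "('a, 'm) monoid_scheme"
    and f :: "'a \<Rightarrow> real"
    and S :: "('a \<Rightarrow> complex) set"
    and sqrt_f h :: "'a \<Rightarrow> complex"
    and M :: real
  assumes "comm_group G" and "finite (carrier G)"
    and "\<forall>x\<in>carrier G. f x \<ge> 0" and "\<exists>x\<in>carrier G. f x \<noteq> 0"
    and "S \<subseteq> carrier (character_group G)"
    and "fourier_supp G (\<lambda>x. complex_of_real (f x)) \<subseteq> S"
    and "S = set_inv\<^bsub>character_group G\<^esub> S"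
  defines "sqrt_f \<equiv> \<lambda>x. complex_of_real (sqrt (f x))"
  assumes "\<forall>\<chi>\<in>carrier (character_group G).
      fourier G h \<chi> = (if \<chi> \<in> S then fourier G sqrt_f \<chi> else 0)"
  defines "M \<equiv> 2 * l1_norm G (\<lambda>\<chi>. fourier G sqrt_f \<chi> - fourier G h \<chi>) * l1_norm G (fourier G h)
      + (l1_norm G (\<lambda>\<chi>. fourier G sqrt_f \<chi> - fourier G h \<chi>))\<^sup>2"
  shows "has_FSOS_supported_in G (\<lambda>x. complex_of_real (f x + M)) S"
proof -
  interpret finite_comm_group G
    using assms(1,2) by (simp add: finite_comm_group_def finite_comm_group_axioms_def)
  have one: "\<one>\<^bsub>character_group G\<^esub> \<in> S"
    using one_in_fourier_supp[OF assms(3,4)] assms(6) by blast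
  have h: "fourier_supp G h \<subseteq> S"
    using assms(9) by (auto simp: fourier_supp_def split: if_splits)
  define g where "g = (\<lambda>x. f x - (cmod (h x))\<^sup>2)"
  \<comment> \<open>The two functions agree on the carrier of \<open>G\<close> only, as \<open>f\<close> may be negative elsewhere.\<close>
  have "fourier G (\<lambda>x. of_real (g x)) \<psi> =
      fourier G (\<lambda>x. of_real ((cmod (sqrt_f x))\<^sup>2 - (cmod (h x))\<^sup>2)) \<psi>" if "\<psi> \<in> dual" for \<psi>
    using that assms(3) by (simp add: fourier_eq g_def sqrt_f_def flip: of_real_power)
  then have l1: "l1_norm G (fourier G (\<lambda>x. of_real (g x))) \<le> M"
    using l1_norm_diff_cmod_square[of sqrt_f h] by (simp add: l1_norm_def M_def)
  have "has_FSOS_supported_in G (\<lambda>x. of_real ((cmod (h x))\<^sup>2 + g x + M)) S"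
    using fourier_supp_diff_cmod_square[OF assms(5) one assms(6) h]
    by (intro has_FSOS_square_plus_l1_norm[OF assms(5) one h _ l1]) (simp add: g_def)
  then show ?thesis by (simp add: g_def)
qed

end
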